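(* Let $p=1\text{-}3\text{-}2$ (classical pattern). For integers $k,\ell\ge 1$ put $m=\max(k,\ell)$. Then: (i) $\displaystyle G_{p}^{12\ldots k,\,12\ldots \ell}(x) = x^{k+\ell-1}C^{\ell+1}(x)+\frac{x^m-x^{k+\ell-1}}{1-x}$. (ii) $\displaystyle G_{p}^{12\ldots k,\,\ell(\ell-1)\ldots 1}(x) = x^{k+\ell-1}C^2(x)$. (iii) $\displaystyle G_{p}^{k(k-1)\ldots 1,\,\ell(\ell-1)\ldots 1}(x) = x^{k+\ell-1}C^{k+1}(x)+\frac{x^m-x^{k+\ell-1}}{1-x}$. (iv) The generating function $\displaystyle G_p(x,y,z)=\sum_{k,\ell\geq0}G_{p}^{k(k-1)\ldots1,\,12\ldots\ell}(x)\,y^kz^{\ell}$ equals $$\frac{1}{1-x(y+z)}\left( x(y+z+yz) +\frac{C(x)-1}{(1-xyC(x))(1-xzC(x))}\right).$$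
   Context: A permutation $\pi=\pi_1\cdots\pi_n$ of $\{1,\dots,n\}$ avoids the classical pattern $1\text{-}3\text{-}2$ if there are no indices $a<b<c$ with $\pi_a<\pi_c<\pi_b$. It begins with the pattern $12\ldots k$ (respectively $k(k-1)\ldots1$) if $n\ge k$ and $\pi_1<\cdots<\pi_k$ (respectively $\pi_1>\cdots>\pi_k$); it ends with the pattern $12\ldots\ell$ (respectively $\ell(\ell-1)\ldots 1$) if $n\ge\ell$ and $\pi_{n-\ell+1}<\cdots<\pi_n$ (respectively $\pi_{n-\ell+1}>\cdots>\pi_n$). The initial and final segments are allowed to overlap. $G_p^{q,r}(x)=\sum_{n\ge1}N_p^{q,r}(n)x^n$, where $N_p^{q,r}(n)$ is the number of permutations of $\{1,\dots,n\}$ that avoid $p$, begin with $q$ and end with $r$ (the empty permutation is not counted). For $k=0$ (respectively $\ell=0$) no condition is imposed on the beginning (respectively the end) of the permutation. $C(x)=\sum_{n\ge0}C_nx^n=\frac{1-\sqrt{1-4x}}{2x}$ is the generating function of the Catalan numbers, and $C^j(x)=(C(x))^j$. *)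

theory Defs
  imports Complex_Main
    "HOL-Computational_Algebra.Formal_Power_Series"
    "HOL-Combinatorics.Multiset_Permutations"
begin

unbundle fps_syntax

section \<open>Permutations and patterns\<close>

text \<open>
  A permutation of \<open>{1..n}\<close> is given in one-line notation, as an element of
  \<^term>\<open>permutations_of_set {1..n}\<close>; list positions are counted from 0.
\<close>

definition avoids_132 :: "nat list \<Rightarrow> bool" where
  "avoids_132 \<pi> \<longleftrightarrow>
     \<not> (\<exists>a b c. a < b \<and> b < c \<and> c < length \<pi> \<and> \<pi> ! a < \<pi> ! c \<and> \<pi> ! c < \<pi> ! b)"

text \<open>The following four conditions hold for every list when the length parameter is 0.\<close>

definition begins_inc :: "nat \<Rightarrow> nat list \<Rightarrow> bool" where
  "begins_inc k \<pi> \<longleftrightarrow> k \<le> length \<pi> \<and> sorted_wrt (<) (take k \<pi>)"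

definition begins_dec :: "nat \<Rightarrow> nat list \<Rightarrow> bool" where
  "begins_dec k \<pi> \<longleftrightarrow> k \<le> length \<pi> \<and> sorted_wrt (>) (take k \<pi>)"

definition ends_inc :: "nat \<Rightarrow> nat list \<Rightarrow> bool" where
  "ends_inc l \<pi> \<longleftrightarrow> l \<le> length \<pi> \<and> sorted_wrt (<) (drop (length \<pi> - l) \<pi>)"

definition ends_dec :: "nat \<Rightarrow> nat list \<Rightarrow> bool" where
  "ends_dec l \<pi> \<longleftrightarrow> l \<le> length \<pi> \<and> sorted_wrt (>) (drop (length \<pi> - l) \<pi>)"

definition perm_count ::
  "(nat list \<Rightarrow> bool) \<Rightarrow> (nat list \<Rightarrow> bool) \<Rightarrow> (nat list \<Rightarrow> bool) \<Rightarrow> nat \<Rightarrow> nat" where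
  "perm_count A B E n = card {\<pi> \<in> permutations_of_set {1..n}. A \<pi> \<and> B \<pi> \<and> E \<pi>}"

text \<open>The empty permutation is not counted.\<close>

definition perm_gf ::
  "(nat list \<Rightarrow> bool) \<Rightarrow> (nat list \<Rightarrow> bool) \<Rightarrow> (nat list \<Rightarrow> bool) \<Rightarrow> real fps" where
  "perm_gf A B E = Abs_fps (\<lambda>n. if n = 0 then 0 else real (perm_count A B E n))"


section \<open>Catalan generating function\<close>

fun catalan :: "nat \<Rightarrow> nat" where
  "catalan 0 = 1"
| "catalan (Suc n) = (\<Sum>i\<le>n. catalan i * catalan (n - i))"

definition catalan_gf :: "real fps" where
  "catalan_gf = Abs_fps (\<lambda>n. real (catalan n))"

lemma catalan_gf_rec: "catalan_gf = 1 + fps_X * catalan_gf ^ 2"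
proof (rule fps_ext)
  fix n
  have sq: "(catalan_gf ^ 2) $ j = real (\<Sum>i\<le>j. catalan i * catalan (j - i))" for j
    by (simp add: catalan_gf_def power2_eq_square fps_mult_nth atLeast0AtMost)
  show "catalan_gf $ n = (1 + fps_X * catalan_gf ^ 2) $ n"
    by (cases n) (simp_all add: sq, simp_all add: catalan_gf_def)
qed

text \<open>The closed form: \<open>fps_radical root 2\<close> is the square root with constant term 1.\<close>

lemma catalan_gf_closed_form:
  "catalan_gf = (1 - fps_radical root 2 (1 - 4 * fps_X)) / (2 * fps_X)"
proof -
  define S where "S = 1 - 2 * fps_X * catalan_gf"
  have "S ^ 2 = 1 - 4 * fps_X * (catalan_gf - fps_X * catalan_gf ^ 2)"
    by (simp add: S_def power2_eq_square algebra_simps)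
  also have "catalan_gf - fps_X * catalan_gf ^ 2 = 1"
    using catalan_gf_rec by (metis add_diff_cancel_right')
  finally have sq: "S ^ 2 = 1 - 4 * fps_X"
    by simp
  have S0: "S $ 0 = 1"
    by (simp add: S_def fps_mult_nth_0)
  have "S = fps_radical root (Suc 1) (1 - 4 * fps_X)"
    by (rule iffD1[OF radical_unique[where a = S]])
       (use sq S0 in \<open>simp_all add: numeral_2_eq_2 fps_mult_nth_0\<close>)
  then have "fps_radical root 2 (1 - 4 * fps_X) = S"
    by (simp add: numeral_2_eq_2[symmetric])
  then have "1 - fps_radical root 2 (1 - 4 * fps_X) = catalan_gf * (2 * fps_X)"
    by (simp add: S_def mult_ac)
  moreover have "(2 * fps_X :: real fps) \<noteq> 0"
    by simp
  ultimately show ?thesis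
    by (metis nonzero_mult_div_cancel_right)
qed


section \<open>Power series in three variables\<close>

text \<open>
  Series in \<open>x, y, z\<close> are elements of \<^typ>\<open>real fps fps fps\<close>: the outermost variable is \<open>z\<close>,
  its coefficients are series in \<open>y\<close>, and the coefficients of those are series in \<open>x\<close>.
  The \<open>z^l y^k\<close> coefficient below is the series in \<open>x\<close> for the pair \<open>(k, l)\<close>.
\<close>

definition perm_gf3 :: "real fps fps fps" where
  "perm_gf3 = Abs_fps (\<lambda>l. Abs_fps (\<lambda>k. perm_gf avoids_132 (begins_dec k) (ends_inc l)))"

definition x_in_xyz :: "real fps \<Rightarrow> real fps fps fps" where
  "x_in_xyz f = fps_const (fps_const f)"

definition var_x :: "real fps fps fps" where
  "var_x = x_in_xyz fps_X"

definition var_y :: "real fps fps fps" where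
  "var_y = fps_const fps_X"

definition var_z :: "real fps fps fps" where
  "var_z = fps_X"

text \<open>
  The coefficients do not form a field here, but the library's division is still the genuine one
  whenever the constant term of the divisor is nonzero.
\<close>

lemma fps3_divide_mult_cancel:
  fixes f g :: "real fps fps fps"
  assumes "f $ 0 $ 0 $ 0 \<noteq> 0"
  shows "(g / f) * f = g"
proof -
  have step: "h * inverse h = 1"
    if "h $ 0 * inverse (h $ 0) = 1" for h :: "'a :: {ring_1, inverse} fps"
    unfolding fps_inverse_def using that by (rule fps_right_inverse)
  have inv: "f * inverse f = 1"
    using assms by (intro step inverse_mult_eq_1')
  have "f $ 0 \<noteq> 0"
    using assms by auto
  then have sd: "subdegree f = 0"
    by simp
  then have "g / f = g * inverse f"
    by (simp add: fps_divide_def)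
  then show ?thesis
    using inv by (simp add: mult_ac)
qed

end

theory Submission
  imports Defs
begin

text \<open>
  Cut a nonempty permutation at its maximum. If it avoids 1-3-2, every entry to the left of the
  maximum exceeds every entry to the right of it, since a smaller entry on the left would form
  1-3-2 together with the maximum and the entry on the right. Hence the avoiders of size
  \<open>n + 1\<close> correspond to pairs \<open>(\<sigma>, \<tau>)\<close> of avoiders of total size \<open>n\<close>
  (\<open>avoider_is_join\<close>, \<open>join_in_avoiders\<close>). This is the source of \<open>C = 1 + x C\<^sup>2\<close>,
  and any property of the permutation that splits into properties of \<open>\<sigma>\<close> and \<open>\<tau>\<close> gives an
  equation between generating functions: disjoint alternatives add, independent conditions on the
  two parts multiply (\<open>avoider_gf_decompose\<close>, \<open>pair_gf_disj\<close>, \<open>pair_gf_prod\<close>).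

  An initial or final run meets the maximum in a controlled way. An increasing initial run either
  stays inside \<open>\<sigma>\<close> or consists of a wholly increasing \<open>\<sigma>\<close> followed by the maximum; a decreasing
  initial run of length \<open>k + 1\<close> either stays inside \<open>\<sigma>\<close>, or \<open>\<sigma>\<close> is empty and \<open>\<tau>\<close> starts with a
  decreasing run of length \<open>k\<close>. Final runs behave in the same way with the two sides exchanged.
  With a single condition imposed, these equations have the solutions \<open>x\<^sup>k C\<^sup>2\<close> for \<open>12\<dots>k\<close> at the
  beginning or \<open>k\<dots>21\<close> at the end, \<open>k \<ge> 1\<close>, and \<open>x\<^sup>k C\<^sup>k\<^sup>+\<^sup>1\<close> for the two other kinds. In
  solving them, \<open>C = 1 / (1 - x C)\<close> does all the work.

  With an increasing beginning and a decreasing end, the conditions on \<open>\<sigma>\<close> and \<open>\<tau>\<close> are independent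
  and (ii) is a product. In (i) an empty \<open>\<tau>\<close> shortens the final run by one and leaves the condition
  at the beginning as it is, unless \<open>\<sigma>\<close> is increasing; this yields a recurrence in \<open>l\<close> whose
  inhomogeneous part \<open>x\<^sup>k\<close>, present while \<open>l \<le> k\<close>, adds up to the geometric sum
  in the formula (\<open>run_recurrence_solution\<close>). Part (iii) satisfies the same recurrence with the
  roles of \<open>k\<close> and \<open>l\<close> exchanged. In (iv) the coefficient at \<open>(k + 1, l + 1)\<close> is \<open>x\<close> times the
  sum of its two neighbours \<open>(k, l + 1)\<close> and \<open>(k + 1, l)\<close> and a product term, with an additional
  \<open>x\<close> at \<open>(1, 1)\<close> for the one-element permutation, so multiplication
  by \<open>1 - x (y + z)\<close> leaves a double geometric series and finitely many boundary terms
  (\<open>perm_gf3_functional_equation\<close>, \<open>geometric_gf3\<close>).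
\<close>

section \<open>Cutting an avoider at its maximum\<close>

definition avoiders :: "nat \<Rightarrow> nat list set" where
  "avoiders n = {\<pi> \<in> permutations_of_set {1..n}. avoids_132 \<pi>}"

text \<open>
  The entries of \<open>\<sigma>\<close> are lifted above those of \<open>\<tau>\<close>: this is the only relative position of the two
  parts that creates no occurrence of 1-3-2 through the maximum.
\<close>

definition join :: "nat list \<Rightarrow> nat list \<Rightarrow> nat list" where
  "join \<sigma> \<tau> = map (\<lambda>i. i + length \<tau>) \<sigma> @ (length \<sigma> + length \<tau> + 1) # \<tau>"

lemma avoiders_iff:
  "\<pi> \<in> avoiders n \<longleftrightarrow> distinct \<pi> \<and> set \<pi> = {1..n} \<and> length \<pi> = n \<and> avoids_132 \<pi>"
  by (auto simp: avoiders_def permutations_of_set_def dest: distinct_card)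

lemma finite_avoiders [simp]: "finite (avoiders n)"
  by (simp add: avoiders_def)

lemma length_avoiders: "\<pi> \<in> avoiders n \<Longrightarrow> length \<pi> = n"
  by (simp add: avoiders_iff)

lemma avoiders_0 [simp]: "avoiders 0 = {[]}"
  by (auto simp: avoiders_iff avoids_132_def)

text \<open>
  An occurrence of 1-3-2 that is not contained in one part has its 1 in \<open>\<sigma>\<close> and its 2 in \<open>\<tau>\<close>, or
  uses the maximum for the 1 or the 2. The former is excluded because \<open>\<sigma>\<close> is lifted above \<open>\<tau>\<close>,
  the latter because the 3 would have to be larger.
\<close>

lemma avoids_132_join:
  assumes "set \<sigma> \<subseteq> {1..length \<sigma>}" "set \<tau> \<subseteq> {1..length \<tau>}"
  shows "avoids_132 (join \<sigma> \<tau>) \<longleftrightarrow> avoids_132 \<sigma> \<and> avoids_132 \<tau>"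
proof
  let ?i = "length \<sigma>" and ?j = "length \<tau>" and ?p = "join \<sigma> \<tau>"
  have left: "?p ! a = \<sigma> ! a + ?j" if "a < ?i" for a
    using that by (simp add: join_def nth_append)
  have mid: "?p ! ?i = ?i + ?j + 1"
    by (simp add: join_def nth_append)
  have right: "?p ! (?i + 1 + a) = \<tau> ! a" for a
    by (simp add: join_def nth_append)
  have len: "length ?p = ?i + 1 + ?j"
    by (simp add: join_def)
  have lb: "1 \<le> \<sigma> ! a" "\<sigma> ! a \<le> ?i" if "a < ?i" for a
    using subsetD[OF assms(1) nth_mem[OF that]] by simp_all
  have rb: "\<tau> ! a \<le> ?j" if "a < ?j" for a
    using subsetD[OF assms(2) nth_mem[OF that]] by simp
  {
    assume av: "avoids_132 ?p"
    show "avoids_132 \<sigma> \<and> avoids_132 \<tau>"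
    proof
      show "avoids_132 \<sigma>" unfolding avoids_132_def
      proof clarify
        fix a b c assume "a < b" "b < c" "c < ?i" "\<sigma> ! a < \<sigma> ! c" "\<sigma> ! c < \<sigma> ! b"
        then have "a < b \<and> b < c \<and> c < length ?p \<and> ?p ! a < ?p ! c \<and> ?p ! c < ?p ! b"
          by (simp add: left len)
        then show False using av unfolding avoids_132_def by blast
      qed
      show "avoids_132 \<tau>" unfolding avoids_132_def
      proof clarify
        fix a b c assume "a < b" "b < c" "c < ?j" "\<tau> ! a < \<tau> ! c" "\<tau> ! c < \<tau> ! b"
        then have "?i + 1 + a < ?i + 1 + b \<and> ?i + 1 + b < ?i + 1 + c \<and> ?i + 1 + c < length ?p \<and>
            ?p ! (?i + 1 + a) < ?p ! (?i + 1 + c) \<and> ?p ! (?i + 1 + c) < ?p ! (?i + 1 + b)"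
          unfolding right len by simp
        then show False using av unfolding avoids_132_def by blast
      qed
    qed
  }
  {
    assume av: "avoids_132 \<sigma> \<and> avoids_132 \<tau>"
    show "avoids_132 ?p" unfolding avoids_132_def
    proof clarify
      fix a b c assume abc: "a < b" "b < c" "c < length ?p" "?p ! a < ?p ! c" "?p ! c < ?p ! b"
      have le: "?p ! d \<le> ?i + ?j + 1" if "d < length ?p" for d
      proof -
        consider "d < ?i" | "d = ?i" | "d > ?i" by linarith
        then show ?thesis
        proof cases
          case 1
          then show ?thesis using lb(2)[of d] left[of d] by simp
        next
          case 2
          then show ?thesis using mid by simp
        next
          case 3
          then obtain e where "d = ?i + 1 + e" using less_iff_Suc_add by auto
          then show ?thesis using rb[of e] right[of e] that len by simp
        qed
      qed
      consider "a < ?i" | "a = ?i" | "a > ?i" by linarith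
      then show False
      proof cases
        case 1
        have "c < ?i"
        proof (rule ccontr)
          assume "\<not> c < ?i"
          then consider "c = ?i" | "c > ?i" by linarith
          then show False
          proof cases
            case 1
            then show False using abc le[of b] mid by simp
          next
            case 2
            then obtain e where e: "c = ?i + 1 + e" using less_iff_Suc_add by auto
            then have "?p ! c \<le> ?j" using rb[of e] right[of e] abc len by simp
            then show False using abc left[of a] \<open>a < ?i\<close> by simp
          qed
        qed
        then have "a < b \<and> b < c \<and> c < ?i \<and> \<sigma> ! a < \<sigma> ! c \<and> \<sigma> ! c < \<sigma> ! b"
          using abc by (simp add: left)
        then show False using av unfolding avoids_132_def by blast
      next
        case 2
        then show False using abc le[of c] mid by simp
      next
        case 3
        define e f g where "e = a - ?i - 1" and "f = b - ?i - 1" and "g = c - ?i - 1"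
        have "a = ?i + 1 + e" "b = ?i + 1 + f" "c = ?i + 1 + g"
          using 3 abc(1,2) by (simp_all add: e_def f_def g_def)
        then have "e < f \<and> f < g \<and> g < ?j \<and> \<tau> ! e < \<tau> ! g \<and> \<tau> ! g < \<tau> ! f"
          using abc by (simp only: right len add_less_cancel_left)
        then show False using av unfolding avoids_132_def by blast
      qed
    qed
  }
qed

lemma join_in_avoiders:
  assumes "\<sigma> \<in> avoiders i" "\<tau> \<in> avoiders j"
  shows "join \<sigma> \<tau> \<in> avoiders (Suc (i + j))"
proof -
  note s = assms[unfolded avoiders_iff]
  have shift: "(\<lambda>a. a + j) ` {1..i} = {j + 1..i + j}"
    using image_add_atLeastAtMost'[of j 1 i] by simp
  have "avoids_132 (join \<sigma> \<tau>)"
    using s by (subst avoids_132_join) auto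
  moreover have "set (join \<sigma> \<tau>) = {1..Suc (i + j)}"
    using s shift by (auto simp: join_def)
  moreover have "distinct (join \<sigma> \<tau>)"
    using s by (auto simp: join_def distinct_map shift)
  ultimately show ?thesis
    using s by (simp add: avoiders_iff) (simp add: join_def)
qed

text \<open>
  This determines the values to the right of the maximum from their number alone.
\<close>

lemma down_closed_eq_interval:
  fixes S :: "nat set"
  assumes "finite S" "0 \<notin> S" "\<And>a b. b \<in> S \<Longrightarrow> 0 < a \<Longrightarrow> a < b \<Longrightarrow> a \<in> S"
  shows "S = {1..card S}"
proof (cases "S = {}")
  case False
  have "S = {1..Max S}"
  proof
    show "S \<subseteq> {1..Max S}"
    proof
      fix s assume "s \<in> S"
      then show "s \<in> {1..Max S}" using assms(1,2) by (cases s) auto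
    qed
    show "{1..Max S} \<subseteq> S"
    proof
      fix a assume a: "a \<in> {1..Max S}"
      show "a \<in> S"
        using assms(3)[of "Max S" a] Max_in[OF assms(1) False] a by (cases "a = Max S") auto
    qed
  qed
  then obtain m where "S = {1..m}" by blast
  then show ?thesis by simp
qed simp

text \<open>
  The values to the right of the maximum are smaller than those to its left, so they form an
  initial segment of \<open>{1..n}\<close>; subtracting its length from the left part standardises that part.
\<close>

lemma avoider_is_join:
  assumes "\<pi> \<in> avoiders (Suc n)"
  obtains i \<sigma> \<tau> where "i \<le> n" "\<sigma> \<in> avoiders i" "\<tau> \<in> avoiders (n - i)" "\<pi> = join \<sigma> \<tau>"
proof -
  note p = assms[unfolded avoiders_iff]
  then have "Suc n \<in> set \<pi>" by simp
  then obtain xs ys where xy: "\<pi> = xs @ Suc n # ys"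
    by (meson split_list)
  have d: "distinct xs" "distinct ys" "set xs \<inter> set ys = {}" "Suc n \<notin> set xs" "Suc n \<notin> set ys"
    using p xy by auto
  have un: "set xs \<union> set ys = {1..n}"
  proof -
    have "insert (Suc n) (set xs \<union> set ys) = insert (Suc n) {1..n}"
      using p xy by (simp add: atLeastAtMostSuc_conv)
    then show ?thesis using d by (subst (asm) insert_ident) auto
  qed
  have len: "length xs + length ys = n"
    using p xy by simp
  have above: "y < x" if x: "x \<in> set xs" and y: "y \<in> set ys" for x y
  proof (rule ccontr)
    assume "\<not> y < x"
    then have lt: "x < y" using x y d(3) by (metis IntI empty_iff linorder_neqE_nat)
    from x obtain a where a: "a < length xs" "xs ! a = x" by (auto simp: in_set_conv_nth)
    from y obtain c where c: "c < length ys" "ys ! c = y" by (auto simp: in_set_conv_nth)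
    have "y \<le> n" using y un by auto
    then have "a < length xs \<and> length xs < length xs + 1 + c \<and> length xs + 1 + c < length \<pi> \<and>
      \<pi> ! a < \<pi> ! (length xs + 1 + c) \<and> \<pi> ! (length xs + 1 + c) < \<pi> ! (length xs)"
      using a c lt by (simp add: xy nth_append)
    then show False using p unfolding avoids_132_def by blast
  qed
  have sy: "set ys = {1..length ys}"
  proof -
    have sub: "set ys \<subseteq> {1..n}" using un by blast
    have "set ys = {1..card (set ys)}"
    proof (rule down_closed_eq_interval)
      fix a b assume ab: "b \<in> set ys" "0 < a" "a < b"
      have "b \<in> {1..n}" using ab(1) un by blast
      then have "a \<in> set xs \<union> set ys" unfolding un using ab by simp
      then show "a \<in> set ys" using above[of a b] ab by auto
    qed (use sub in auto)
    then show ?thesis using d by (simp add: distinct_card)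
  qed
  have sx: "set xs = {length ys + 1..n}"
  proof -
    have "set xs = {1..n} - {1..length ys}" using un d(3) sy by blast
    also have "\<dots> = {length ys + 1..n}" by (rule set_eqI) (simp, linarith)
    finally show ?thesis .
  qed
  define \<sigma> where "\<sigma> = map (\<lambda>i. i - length ys) xs"
  have xs_eq: "map (\<lambda>i. i + length ys) \<sigma> = xs"
    unfolding \<sigma>_def map_map by (rule map_idI) (simp add: sx)
  have ls: "length \<sigma> = length xs" by (simp add: \<sigma>_def)
  have pj: "\<pi> = join \<sigma> ys"
    using xs_eq ls len xy by (simp add: join_def)
  have ss: "set \<sigma> = {1..length xs}"
  proof -
    have "(\<lambda>i. i + length ys) ` set \<sigma> = set xs"
      by (subst xs_eq[symmetric]) simp
    also have "\<dots> = (\<lambda>i. i + length ys) ` {1..length xs}"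
      unfolding sx image_add_atLeastAtMost' using len by (simp add: add.commute)
    finally show ?thesis
      by (subst (asm) inj_image_eq_iff) (simp_all add: inj_def)
  qed
  have "distinct \<sigma>" using d(1) xs_eq by (metis distinct_map)
  moreover have "avoids_132 \<sigma>" "avoids_132 ys"
    using p avoids_132_join[of \<sigma> ys] ss sy ls by (auto simp: pj)
  ultimately have "\<sigma> \<in> avoiders (length xs)" "ys \<in> avoiders (n - length xs)"
    using ss sy ls d(2) len by (auto simp: avoiders_iff)
  then show ?thesis
    using that[of "length xs" \<sigma> ys] len pj by simp
qed

text \<open>
  The cut is recovered as the position of the unique maximum.
\<close>

lemma join_inject:
  assumes "\<sigma> \<in> avoiders i" "\<tau> \<in> avoiders (n - i)" "\<sigma>' \<in> avoiders i'" "\<tau>' \<in> avoiders (n - i')"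
    and "i \<le> n" "i' \<le> n" and eq: "join \<sigma> \<tau> = join \<sigma>' \<tau>'"
  shows "\<sigma> = \<sigma>' \<and> \<tau> = \<tau>'"
proof -
  note s = assms(1-4)[unfolded avoiders_iff]
  let ?N = "Suc n"
  have "map (\<lambda>a. a + length \<tau>) \<sigma> @ ?N # \<tau> = map (\<lambda>a. a + length \<tau>') \<sigma>' @ ?N # \<tau>'"
    using eq s assms(5,6) by (simp add: join_def)
  moreover have "?N \<notin> set (map (\<lambda>a. a + length \<tau>) \<sigma>)" "?N \<notin> set \<tau>"
    "?N \<notin> set (map (\<lambda>a. a + length \<tau>') \<sigma>')" "?N \<notin> set \<tau>'"
    using s assms(5,6) by auto
  ultimately have "map (\<lambda>a. a + length \<tau>) \<sigma> = map (\<lambda>a. a + length \<tau>') \<sigma>'" "\<tau> = \<tau>'"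
    by (auto simp: append_Cons_eq_iff)
  then show ?thesis by (auto simp: inj_map_eq_map)
qed

section \<open>Generating functions of properties\<close>

text \<open>
  The empty permutation is counted, unlike in \<open>perm_gf\<close>: either part of a cut may be empty.
\<close>

definition avoider_gf :: "(nat list \<Rightarrow> bool) \<Rightarrow> real fps" where
  "avoider_gf P = Abs_fps (\<lambda>n. real (card {\<pi> \<in> avoiders n. P \<pi>}))"

text \<open>
  Pairs are counted by their total size; the maximum, which adds 1, is accounted for by the
  factor \<open>x\<close> in the lemma below.
\<close>

definition pair_gf :: "(nat list \<Rightarrow> nat list \<Rightarrow> bool) \<Rightarrow> real fps" where
  "pair_gf Q = Abs_fps (\<lambda>n. \<Sum>i\<le>n.
     real (card {(\<sigma>, \<tau>). \<sigma> \<in> avoiders i \<and> \<tau> \<in> avoiders (n - i) \<and> Q \<sigma> \<tau>}))"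

lemma avoider_gf_decompose:
  "avoider_gf P = of_bool (P []) + fps_X * pair_gf (\<lambda>\<sigma> \<tau>. P (join \<sigma> \<tau>))"
proof (rule fps_ext)
  fix n
  show "avoider_gf P $ n = (of_bool (P []) + fps_X * pair_gf (\<lambda>\<sigma> \<tau>. P (join \<sigma> \<tau>))) $ n"
  proof (cases n)
    case 0
    have "{\<pi>. \<pi> = [] \<and> P \<pi>} = (if P [] then {[]} else {})" by auto
    then show ?thesis using 0 by (simp add: avoider_gf_def)
  next
    case (Suc m)
    define T where "T i = {(\<sigma>, \<tau>). \<sigma> \<in> avoiders i \<and> \<tau> \<in> avoiders (m - i) \<and> P (join \<sigma> \<tau>)}" for i
    have fin: "finite (T i)" for i
      by (rule finite_subset[of _ "avoiders i \<times> avoiders (m - i)"]) (auto simp: T_def)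
    have "bij_betw (\<lambda>(\<sigma>, \<tau>). join \<sigma> \<tau>) (\<Union>i\<le>m. T i) {\<pi> \<in> avoiders (Suc m). P \<pi>}"
    proof (rule bij_betw_imageI)
      show "inj_on (\<lambda>(\<sigma>, \<tau>). join \<sigma> \<tau>) (\<Union>i\<le>m. T i)"
        by (rule inj_onI) (auto simp: T_def dest: join_inject)
      show "(\<lambda>(\<sigma>, \<tau>). join \<sigma> \<tau>) ` (\<Union>i\<le>m. T i) = {\<pi> \<in> avoiders (Suc m). P \<pi>}"
      proof (intro equalityI subsetI)
        fix \<pi> assume "\<pi> \<in> (\<lambda>(\<sigma>, \<tau>). join \<sigma> \<tau>) ` (\<Union>i\<le>m. T i)"
        then obtain i \<sigma> \<tau> where "i \<le> m" "\<sigma> \<in> avoiders i" "\<tau> \<in> avoiders (m - i)" "P (join \<sigma> \<tau>)"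
          "\<pi> = join \<sigma> \<tau>"
          by (auto simp: T_def)
        then show "\<pi> \<in> {\<pi> \<in> avoiders (Suc m). P \<pi>}"
          using join_in_avoiders[of \<sigma> i \<tau> "m - i"] by simp
      next
        fix \<pi> assume pi: "\<pi> \<in> {\<pi> \<in> avoiders (Suc m). P \<pi>}"
        then obtain i \<sigma> \<tau> where "i \<le> m" "\<sigma> \<in> avoiders i" "\<tau> \<in> avoiders (m - i)" "\<pi> = join \<sigma> \<tau>"
          by (auto elim: avoider_is_join)
        then have "(\<sigma>, \<tau>) \<in> (\<Union>i\<le>m. T i)" using pi by (auto simp: T_def)
        then show "\<pi> \<in> (\<lambda>(\<sigma>, \<tau>). join \<sigma> \<tau>) ` (\<Union>i\<le>m. T i)"
          using \<open>\<pi> = join \<sigma> \<tau>\<close> by force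
      qed
    qed
    then have "card {\<pi> \<in> avoiders (Suc m). P \<pi>} = card (\<Union>i\<le>m. T i)"
      by (simp add: bij_betw_same_card)
    also have "\<dots> = (\<Sum>i\<le>m. card (T i))"
      by (rule card_UN_disjoint) (use fin in \<open>auto simp: T_def dest: length_avoiders\<close>)
    finally show ?thesis
      using Suc by (simp add: avoider_gf_def pair_gf_def T_def)
  qed
qed

lemma pair_gf_cong:
  assumes "\<And>i j \<sigma> \<tau>. \<sigma> \<in> avoiders i \<Longrightarrow> \<tau> \<in> avoiders j \<Longrightarrow> P \<sigma> \<tau> \<longleftrightarrow> Q \<sigma> \<tau>"
  shows "pair_gf P = pair_gf Q"
proof -
  have "{(\<sigma>, \<tau>). \<sigma> \<in> avoiders i \<and> \<tau> \<in> avoiders j \<and> P \<sigma> \<tau>} =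
        {(\<sigma>, \<tau>). \<sigma> \<in> avoiders i \<and> \<tau> \<in> avoiders j \<and> Q \<sigma> \<tau>}" for i j
    using assms by blast
  then show ?thesis by (simp add: pair_gf_def)
qed

lemma avoider_gf_disj:
  assumes "\<And>\<pi>. P \<pi> \<Longrightarrow> Q \<pi> \<Longrightarrow> False"
  shows "avoider_gf (\<lambda>\<pi>. P \<pi> \<or> Q \<pi>) = avoider_gf P + avoider_gf Q"
proof (rule fps_ext)
  fix n
  have "{\<pi> \<in> avoiders n. P \<pi> \<or> Q \<pi>} = {\<pi> \<in> avoiders n. P \<pi>} \<union> {\<pi> \<in> avoiders n. Q \<pi>}"
    by blast
  moreover have "{\<pi> \<in> avoiders n. P \<pi>} \<inter> {\<pi> \<in> avoiders n. Q \<pi>} = {}"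
    using assms by blast
  ultimately show "avoider_gf (\<lambda>\<pi>. P \<pi> \<or> Q \<pi>) $ n = (avoider_gf P + avoider_gf Q) $ n"
    by (simp add: avoider_gf_def card_Un_disjoint)
qed

lemma pair_gf_disj:
  assumes "\<And>\<sigma> \<tau>. P \<sigma> \<tau> \<Longrightarrow> Q \<sigma> \<tau> \<Longrightarrow> False"
  shows "pair_gf (\<lambda>\<sigma> \<tau>. P \<sigma> \<tau> \<or> Q \<sigma> \<tau>) = pair_gf P + pair_gf Q"
proof -
  define S where "S R i j = {(\<sigma>, \<tau>). \<sigma> \<in> avoiders i \<and> \<tau> \<in> avoiders j \<and> R \<sigma> \<tau>}" for R i j
  have fin: "finite (S R i j)" for R i j
    by (rule finite_subset[of _ "avoiders i \<times> avoiders j"]) (auto simp: S_def)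
  have "S (\<lambda>\<sigma> \<tau>. P \<sigma> \<tau> \<or> Q \<sigma> \<tau>) i j = S P i j \<union> S Q i j" for i j
    by (auto simp: S_def)
  moreover have "S P i j \<inter> S Q i j = {}" for i j
    using assms by (auto simp: S_def)
  ultimately have "card (S (\<lambda>\<sigma> \<tau>. P \<sigma> \<tau> \<or> Q \<sigma> \<tau>) i j) = card (S P i j) + card (S Q i j)" for i j
    by (simp add: fin card_Un_disjoint)
  then show ?thesis
    by (intro fps_ext) (simp add: pair_gf_def S_def sum.distrib)
qed

lemma pair_gf_prod:
  "pair_gf (\<lambda>\<sigma> \<tau>. P \<sigma> \<and> Q \<tau>) = avoider_gf P * avoider_gf Q"
proof (rule fps_ext)
  fix n
  have "{(\<sigma>, \<tau>). \<sigma> \<in> avoiders i \<and> \<tau> \<in> avoiders j \<and> P \<sigma> \<and> Q \<tau>} =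
        {\<sigma> \<in> avoiders i. P \<sigma>} \<times> {\<tau> \<in> avoiders j. Q \<tau>}" for i j
    by auto
  then show "pair_gf (\<lambda>\<sigma> \<tau>. P \<sigma> \<and> Q \<tau>) $ n = (avoider_gf P * avoider_gf Q) $ n"
    by (simp add: pair_gf_def avoider_gf_def fps_mult_nth card_cartesian_product atLeast0AtMost)
qed

lemma avoider_gf_singleton:
  assumes "\<alpha> \<in> avoiders n"
  shows "avoider_gf (\<lambda>\<pi>. \<pi> = \<alpha> \<and> P \<pi>) = of_bool (P \<alpha>) * fps_X ^ n"
proof (rule fps_ext)
  fix m
  have "{\<pi> \<in> avoiders m. \<pi> = \<alpha> \<and> P \<pi>} = (if m = n \<and> P \<alpha> then {\<alpha>} else {})"
    using assms by (auto dest: length_avoiders)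
  then show "avoider_gf (\<lambda>\<pi>. \<pi> = \<alpha> \<and> P \<pi>) $ m = (of_bool (P \<alpha>) * fps_X ^ n) $ m"
    by (simp add: avoider_gf_def)
qed

text \<open>
  Both series satisfy \<open>F = 1 + x F\<^sup>2\<close>. Two solutions \<open>F\<close> and \<open>G\<close> agree, because
  \<open>(F - G) (1 - x (F + G)) = 0\<close> and the second factor has constant term 1.
\<close>

lemma avoider_gf_True: "avoider_gf (\<lambda>_. True) = catalan_gf"
proof -
  let ?F = "avoider_gf (\<lambda>_. True)" and ?C = catalan_gf
  have "?F = 1 + fps_X * ?F ^ 2"
    using avoider_gf_decompose[of "\<lambda>_. True"] pair_gf_prod[of "\<lambda>_. True" "\<lambda>_. True"]
    by (simp add: power2_eq_square)
  moreover have "?C = 1 + fps_X * ?C ^ 2" by (rule catalan_gf_rec)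
  ultimately have "(?F - ?C) * (1 - fps_X * (?F + ?C)) = 0"
    by algebra
  moreover have "1 - fps_X * (?F + ?C) \<noteq> 0"
  proof
    assume "1 - fps_X * (?F + ?C) = 0"
    then have "(1 - fps_X * (?F + ?C)) $ 0 = 0" by simp
    then show False by simp
  qed
  ultimately show ?thesis by simp
qed

section \<open>Runs and the maximum\<close>

definition ascending :: "nat \<Rightarrow> nat list" where
  "ascending n = [1..<Suc n]"

definition descending :: "nat \<Rightarrow> nat list" where
  "descending n = rev (ascending n)"

text \<open>
  A run that reaches the maximum \<open>N\<close> has to stop there.
\<close>

lemma begins_inc_around_max:
  assumes "\<And>x. x \<in> set ys \<Longrightarrow> x < N" "\<And>x. x \<in> set xs \<Longrightarrow> x < N"
  shows "begins_inc (Suc k) (xs @ N # ys) \<longleftrightarrow>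
    begins_inc (Suc k) xs \<or> length xs = k \<and> sorted_wrt (<) xs"
proof -
  consider "Suc k \<le> length xs" | "k = length xs" | d where "k = length xs + Suc d"
    by (metis less_iff_Suc_add add_Suc_right linorder_neqE_nat not_less_eq_eq le_eq_less_or_eq)
  then show ?thesis
  proof cases
    case 3
    have "\<not> begins_inc (Suc k) (xs @ N # ys)"
    proof (cases ys)
      case (Cons y ys')
      then show ?thesis using 3 assms(1)[of y] by (auto simp: begins_inc_def sorted_wrt_append)
    qed (use 3 in \<open>simp add: begins_inc_def\<close>)
    then show ?thesis using 3 by (simp add: begins_inc_def)
  qed (use assms(2) in \<open>auto simp: begins_inc_def sorted_wrt_append\<close>)
qed

text \<open>
  A decreasing run cannot climb to the maximum \<open>N\<close>, so it contains \<open>N\<close> only as its first entry.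
\<close>

lemma begins_dec_around_max:
  assumes "\<And>x. x \<in> set ys \<Longrightarrow> x < N" "\<And>x. x \<in> set xs \<Longrightarrow> x < N"
  shows "begins_dec (Suc k) (xs @ N # ys) \<longleftrightarrow>
    begins_dec (Suc k) xs \<or> xs = [] \<and> begins_dec k ys"
proof -
  consider "Suc k \<le> length xs" | "xs = []" | x xs' where "xs = x # xs'" "length xs \<le> k"
    by (metis list.exhaust not_less_eq_eq)
  then show ?thesis
  proof cases
    case 2
    have "set (take k ys) \<subseteq> set ys" by (rule set_take_subset)
    then show ?thesis using 2 assms(1) by (auto simp: begins_dec_def)
  next
    case 3
    then obtain d where "Suc k = length xs + Suc d"
      by (metis add_Suc_right le_Suc_ex)
    then have "\<not> begins_dec (Suc k) (xs @ N # ys)"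
      using 3 assms(2)[of x] by (auto simp: begins_dec_def sorted_wrt_append)
    then show ?thesis using 3 by (simp add: begins_dec_def)
  qed (auto simp: begins_dec_def)
qed

lemma begins_shift [simp]:
  "begins_inc k (map (\<lambda>i. i + c) \<pi>) \<longleftrightarrow> begins_inc k \<pi>"
  "begins_dec k (map (\<lambda>i. i + c) \<pi>) \<longleftrightarrow> begins_dec k \<pi>"
  by (simp_all add: begins_inc_def begins_dec_def take_map sorted_wrt_map)

text \<open>
  Reversal transfers the two lemmas on initial runs to final runs.
\<close>

lemma ends_iff_begins_rev:
  "ends_inc l \<pi> \<longleftrightarrow> begins_dec l (rev \<pi>)"
  "ends_dec l \<pi> \<longleftrightarrow> begins_inc l (rev \<pi>)"
  by (simp_all add: ends_inc_def ends_dec_def begins_inc_def begins_dec_def take_rev sorted_wrt_rev)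

lemma ascending_props:
  "sorted_wrt (<) (ascending n)" "length (ascending n) = n" "set (ascending n) = {1..n}"
  by (auto simp: ascending_def simp del: upt_Suc)

lemma ascending_nth: "i < n \<Longrightarrow> ascending n ! i = Suc i"
  by (simp add: ascending_def del: upt_Suc)

lemma increasing_avoider:
  assumes "\<pi> \<in> avoiders n"
  shows "sorted_wrt (<) \<pi> \<longleftrightarrow> \<pi> = ascending n"
proof
  assume "sorted_wrt (<) \<pi>"
  moreover have "set \<pi> = set (ascending n)"
    using assms by (simp add: avoiders_iff ascending_props)
  ultimately show "\<pi> = ascending n"
    using ascending_props(1) by (intro strict_sorted_equal)
qed (simp add: ascending_props)

lemma ascending_in_avoiders: "ascending n \<in> avoiders n"
proof -
  have "avoids_132 (ascending n)"
    unfolding avoids_132_def ascending_props(2)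
  proof clarify
    fix a b c assume "a < b" "b < c" "c < n" "ascending n ! c < ascending n ! b"
    then show False by (simp add: ascending_nth)
  qed
  then show ?thesis
    by (simp add: avoiders_iff ascending_props) (simp add: ascending_def)
qed

lemma decreasing_avoider:
  assumes "\<pi> \<in> avoiders n"
  shows "sorted_wrt (<) (rev \<pi>) \<longleftrightarrow> \<pi> = descending n"
proof
  assume "sorted_wrt (<) (rev \<pi>)"
  moreover have "set (rev \<pi>) = set (ascending n)"
    using assms by (simp add: avoiders_iff ascending_props)
  ultimately have "rev \<pi> = ascending n"
    using ascending_props(1) by (intro strict_sorted_equal)
  then show "\<pi> = descending n"
    by (metis descending_def rev_rev_ident)
qed (simp add: descending_def ascending_props)

lemma descending_in_avoiders: "descending n \<in> avoiders n"
proof -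
  have "avoids_132 (descending n)"
    unfolding avoids_132_def descending_def length_rev ascending_props(2)
  proof clarify
    fix a b c assume "a < b" "b < c" "c < n" "rev (ascending n) ! a < rev (ascending n) ! c"
    then show False by (simp add: rev_nth ascending_nth ascending_props(2))
  qed
  then show ?thesis
    using ascending_in_avoiders[of n] by (simp add: avoiders_iff descending_def)
qed

context
  fixes \<sigma> \<tau> :: "nat list" and i j m :: nat
  assumes \<sigma>: "\<sigma> \<in> avoiders i" and \<tau>: "\<tau> \<in> avoiders j"
begin

lemma join_below_max:
  shows "x \<in> set \<tau> \<Longrightarrow> x < length \<sigma> + length \<tau> + 1"
    and "x \<in> set (map (\<lambda>i. i + length \<tau>) \<sigma>) \<Longrightarrow> x < length \<sigma> + length \<tau> + 1"
  using \<sigma> \<tau> by (auto simp: avoiders_iff)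

lemma begins_inc_join:
  "begins_inc (Suc m) (join \<sigma> \<tau>) \<longleftrightarrow> begins_inc (Suc m) \<sigma> \<or> \<sigma> = ascending m"
proof -
  have "length \<sigma> = m \<and> sorted_wrt (<) \<sigma> \<longleftrightarrow> \<sigma> = ascending m"
    using increasing_avoider[OF \<sigma>] length_avoiders[OF \<sigma>] by (auto simp: ascending_props)
  then show ?thesis
    unfolding join_def
    by (subst begins_inc_around_max) (use join_below_max in \<open>auto simp: sorted_wrt_map\<close>)
qed

lemma begins_dec_join:
  "begins_dec (Suc m) (join \<sigma> \<tau>) \<longleftrightarrow> begins_dec (Suc m) \<sigma> \<or> \<sigma> = [] \<and> begins_dec m \<tau>"
  unfolding join_def
  by (subst begins_dec_around_max) (use join_below_max in auto)

lemma rev_join: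
  "rev (join \<sigma> \<tau>) = rev \<tau> @ (length \<sigma> + length \<tau> + 1) # map (\<lambda>i. i + length \<tau>) (rev \<sigma>)"
  by (simp add: join_def rev_map)

lemma ends_inc_join:
  "ends_inc (Suc m) (join \<sigma> \<tau>) \<longleftrightarrow> ends_inc (Suc m) \<tau> \<or> \<tau> = [] \<and> ends_inc m \<sigma>"
  unfolding ends_iff_begins_rev rev_join
  by (subst begins_dec_around_max) (use join_below_max in auto)

lemma ends_dec_join:
  "ends_dec (Suc m) (join \<sigma> \<tau>) \<longleftrightarrow> ends_dec (Suc m) \<tau> \<or> \<tau> = descending m"
proof -
  have "length \<tau> = m \<and> sorted_wrt (<) (rev \<tau>) \<longleftrightarrow> \<tau> = descending m"
    using decreasing_avoider[OF \<tau>] length_avoiders[OF \<tau>]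
    by (auto simp: descending_def ascending_props)
  then show ?thesis
    unfolding ends_iff_begins_rev rev_join
    by (subst begins_inc_around_max) (use join_below_max in auto)
qed

end

lemma begins_ends_0 [simp]:
  "begins_inc 0 \<pi>" "begins_dec 0 \<pi>" "ends_inc 0 \<pi>" "ends_dec 0 \<pi>"
  by (simp_all add: begins_inc_def begins_dec_def ends_inc_def ends_dec_def)

lemma begins_ends_Nil [simp]:
  "begins_inc k [] \<longleftrightarrow> k = 0" "begins_dec k [] \<longleftrightarrow> k = 0"
  "ends_inc k [] \<longleftrightarrow> k = 0" "ends_dec k [] \<longleftrightarrow> k = 0"
  by (auto simp: begins_inc_def begins_dec_def ends_inc_def ends_dec_def)

text \<open>
  The increasing and the decreasing permutation are the ones that occur as a whole part of the
  cut in a run through the maximum, so their own runs enter the recurrences.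
\<close>

lemma runs_ascending:
  "begins_inc l (ascending k) \<longleftrightarrow> l \<le> k" "ends_inc l (ascending k) \<longleftrightarrow> l \<le> k"
  by (auto simp: begins_inc_def ends_inc_def sorted_wrt_take sorted_wrt_drop ascending_props)

lemma runs_descending:
  "begins_dec l (descending k) \<longleftrightarrow> l \<le> k" "ends_dec l (descending k) \<longleftrightarrow> l \<le> k"
  by (simp_all add: ends_iff_begins_rev descending_def runs_ascending(1))
    (simp add: ends_iff_begins_rev(1)[symmetric] runs_ascending(2))

section \<open>One condition\<close>

text \<open>
  This is \<open>1 + x C\<^sup>2 = C\<close> multiplied by \<open>Y\<close>; with an opaque \<open>Y\<close> it applies to monomials with
  symbolic exponents.
\<close>

lemma catalan_absorb: "Y + fps_X * (Y * catalan_gf ^ 2) = Y * catalan_gf"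
  using catalan_gf_rec by algebra

text \<open>
  The equation gives \<open>A (1 - x C) = x B\<close>, and \<open>C\<close> is the inverse of \<open>1 - x C\<close>.
\<close>

lemma catalan_solve: "A = fps_X * (A * catalan_gf + B) \<Longrightarrow> A = fps_X * catalan_gf * B"
  using catalan_gf_rec by algebra

lemma catalan_power_step:
  "catalan_gf ^ Suc l + fps_X * catalan_gf ^ Suc (Suc (Suc l)) = catalan_gf ^ Suc (Suc l)"
  using catalan_absorb[of "catalan_gf ^ Suc l"] by (simp add: power2_eq_square mult_ac)

lemma avoider_gf_Nil: "avoider_gf (\<lambda>\<pi>. \<pi> = [] \<and> P \<pi>) = of_bool (P [])"
  using avoider_gf_singleton[of "[]" 0 P] by simp

lemma avoider_gf_eq_Nil: "avoider_gf (\<lambda>\<pi>. \<pi> = []) = 1"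
  using avoider_gf_Nil[of "\<lambda>_. True"] by simp

lemma avoider_gf_begins_inc_or_increasing:
  "avoider_gf (\<lambda>\<pi>. begins_inc (Suc k) \<pi> \<or> \<pi> = ascending k) =
   avoider_gf (begins_inc (Suc k)) + fps_X ^ k"
  using avoider_gf_singleton[OF ascending_in_avoiders[of k], of "\<lambda>_. True"]
  by (subst avoider_gf_disj) (auto simp: runs_ascending)

lemma avoider_gf_ends_dec_or_decreasing:
  "avoider_gf (\<lambda>\<pi>. ends_dec (Suc k) \<pi> \<or> \<pi> = descending k) =
   avoider_gf (ends_dec (Suc k)) + fps_X ^ k"
  using avoider_gf_singleton[OF descending_in_avoiders[of k], of "\<lambda>_. True"]
  by (subst avoider_gf_disj) (auto simp: runs_descending)

lemma avoider_gf_begins_inc: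
  "avoider_gf (begins_inc (Suc k)) = fps_X ^ Suc k * catalan_gf ^ 2"
proof -
  let ?A = "avoider_gf (begins_inc (Suc k))"
  have "pair_gf (\<lambda>\<sigma> \<tau>. begins_inc (Suc k) (join \<sigma> \<tau>)) =
        pair_gf (\<lambda>\<sigma> \<tau>. (begins_inc (Suc k) \<sigma> \<or> \<sigma> = ascending k) \<and> True)"
    by (rule pair_gf_cong) (simp add: begins_inc_join)
  then have "?A = fps_X * (?A * catalan_gf + fps_X ^ k * catalan_gf)"
    unfolding pair_gf_prod avoider_gf_begins_inc_or_increasing avoider_gf_True
    by (subst avoider_gf_decompose) (simp add: distrib_right)
  from catalan_solve[OF this] show ?thesis
    by (simp add: power2_eq_square mult_ac)
qed

lemma avoider_gf_ends_dec:
  "avoider_gf (ends_dec (Suc l)) = fps_X ^ Suc l * catalan_gf ^ 2"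
proof -
  let ?A = "avoider_gf (ends_dec (Suc l))"
  have "pair_gf (\<lambda>\<sigma> \<tau>. ends_dec (Suc l) (join \<sigma> \<tau>)) =
        pair_gf (\<lambda>\<sigma> \<tau>. True \<and> (ends_dec (Suc l) \<tau> \<or> \<tau> = descending l))"
    by (rule pair_gf_cong) (simp add: ends_dec_join)
  then have "?A = fps_X * (?A * catalan_gf + fps_X ^ l * catalan_gf)"
    unfolding pair_gf_prod avoider_gf_ends_dec_or_decreasing avoider_gf_True
    by (subst avoider_gf_decompose) (simp add: distrib_left mult.commute)
  from catalan_solve[OF this] show ?thesis
    by (simp add: power2_eq_square mult_ac)
qed

text \<open>
  The series of the left parts \<open>\<sigma>\<close> for which the whole permutation begins with \<open>12\<dots>(k + 1)\<close>;
  the next lemma does the same for the right parts and a decreasing end.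
\<close>

lemma avoider_gf_left_part_begins_inc:
  "avoider_gf (\<lambda>\<pi>. begins_inc (Suc k) \<pi> \<or> \<pi> = ascending k) = fps_X ^ k * catalan_gf"
  unfolding avoider_gf_begins_inc_or_increasing avoider_gf_begins_inc
  using catalan_absorb[of "fps_X ^ k"] by (simp add: mult_ac add_ac)

lemma avoider_gf_right_part_ends_dec:
  "avoider_gf (\<lambda>\<pi>. ends_dec (Suc l) \<pi> \<or> \<pi> = descending l) = fps_X ^ l * catalan_gf"
  unfolding avoider_gf_ends_dec_or_decreasing avoider_gf_ends_dec
  using catalan_absorb[of "fps_X ^ l"] by (simp add: mult_ac add_ac)

lemma avoider_gf_begins_dec_rec:
  "avoider_gf (begins_dec (Suc k)) =
     fps_X * (avoider_gf (begins_dec (Suc k)) * catalan_gf + avoider_gf (begins_dec k))"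
proof -
  have "pair_gf (\<lambda>\<sigma> \<tau>. begins_dec (Suc k) (join \<sigma> \<tau>)) =
        pair_gf (\<lambda>\<sigma> \<tau>. (begins_dec (Suc k) \<sigma> \<and> True) \<or> (\<sigma> = [] \<and> begins_dec k \<tau>))"
    by (rule pair_gf_cong) (simp add: begins_dec_join)
  also have "\<dots> = avoider_gf (begins_dec (Suc k)) * catalan_gf + avoider_gf (begins_dec k)"
    by (subst pair_gf_disj, force)
       (simp only: pair_gf_prod avoider_gf_True avoider_gf_eq_Nil mult_1_left)
  finally show ?thesis
    by (subst avoider_gf_decompose) simp
qed

lemma avoider_gf_ends_inc_rec:
  "avoider_gf (ends_inc (Suc l)) =
     fps_X * (avoider_gf (ends_inc (Suc l)) * catalan_gf + avoider_gf (ends_inc l))"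
proof -
  have "pair_gf (\<lambda>\<sigma> \<tau>. ends_inc (Suc l) (join \<sigma> \<tau>)) =
        pair_gf (\<lambda>\<sigma> \<tau>. (True \<and> ends_inc (Suc l) \<tau>) \<or> (ends_inc l \<sigma> \<and> \<tau> = []))"
    by (rule pair_gf_cong) (auto simp add: ends_inc_join)
  also have "\<dots> = avoider_gf (ends_inc (Suc l)) * catalan_gf + avoider_gf (ends_inc l)"
    by (subst pair_gf_disj, force)
       (simp only: pair_gf_prod avoider_gf_True avoider_gf_eq_Nil mult_1_left mult_1_right mult.commute)
  finally show ?thesis
    by (subst avoider_gf_decompose) simp
qed

lemma avoider_gf_begins_dec:
  "avoider_gf (begins_dec k) = fps_X ^ k * catalan_gf ^ Suc k"
proof (induction k)
  case 0
  then show ?case using avoider_gf_True by simp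
next
  case (Suc k)
  then show ?case
    using catalan_solve[OF avoider_gf_begins_dec_rec[of k]] by (simp add: mult_ac)
qed

lemma avoider_gf_ends_inc:
  "avoider_gf (ends_inc l) = fps_X ^ l * catalan_gf ^ Suc l"
proof (induction l)
  case 0
  then show ?case using avoider_gf_True by simp
next
  case (Suc l)
  then show ?case
    using catalan_solve[OF avoider_gf_ends_inc_rec[of l]] by (simp add: mult_ac)
qed

section \<open>Two conditions\<close>

text \<open>
  Subtracting \<open>x\<^sup>k\<^sup>+\<^sup>l\<^sup>+\<^sup>1 C\<^sup>l\<^sup>+\<^sup>2\<close> from \<open>a (l + 1)\<close> removes every \<open>C\<close> from the recurrence, by
  \<open>1 + x C\<^sup>2 = C\<close>. The remainder \<open>b l\<close> obeys \<open>b (l + 1) = x b l + [l < k] x\<^sup>k\<^sup>+\<^sup>1\<close> with \<open>b 0 = 0\<close>.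
  Multiplied by \<open>1 - x\<close> it is a difference of two monomials: the larger exponent grows in every
  step, the smaller one only once \<open>l\<close> has reached \<open>k\<close>.
\<close>

lemma run_recurrence_solution:
  fixes a :: "nat \<Rightarrow> real fps"
  assumes base: "a 0 = fps_X ^ Suc k * catalan_gf ^ 2"
    and step: "\<And>l. a (Suc l) = fps_X * (fps_X ^ k * catalan_gf * (fps_X ^ Suc l * catalan_gf ^ Suc (Suc l))
                 + a l + of_bool (l \<le> k) * fps_X ^ k)"
  shows "a (Suc l) = fps_X ^ Suc (k + l) * catalan_gf ^ Suc (Suc l)
           + (fps_X ^ max (Suc k) (Suc l) - fps_X ^ Suc (k + l)) / (1 - fps_X)"
proof -
  let ?X = "fps_X :: real fps" and ?C = catalan_gf
  define b where "b l = a (Suc l) - ?X ^ Suc (k + l) * ?C ^ Suc (Suc l)" for l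
  have key: "(1 - ?X) * b l = ?X ^ max (Suc k) (Suc l) - ?X ^ Suc (k + l)" for l
  proof (induction l)
    case 0
    have "b 0 = ?X ^ Suc k * (1 + ?X * ?C ^ 2 + ?X * ?C ^ 3 - ?C ^ 2)"
      by (simp add: b_def step base algebra_simps power2_eq_square power3_eq_cube)
    also have "1 + ?X * ?C ^ 2 + ?X * ?C ^ 3 - ?C ^ 2 = 0"
      using catalan_gf_rec by algebra
    finally show ?case by simp
  next
    case (Suc l)
    have "a (Suc (Suc l)) = ?X ^ Suc (k + Suc l) * (?C ^ Suc (Suc l) + ?X * ?C ^ Suc (Suc (Suc (Suc l))))
        + ?X * b l + of_bool (Suc l \<le> k) * ?X ^ Suc k"
      by (subst step) (simp add: b_def algebra_simps power_add)
    also have "?C ^ Suc (Suc l) + ?X * ?C ^ Suc (Suc (Suc (Suc l))) = ?C ^ Suc (Suc (Suc l))"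
      by (rule catalan_power_step)
    finally have "b (Suc l) = ?X * b l + of_bool (Suc l \<le> k) * ?X ^ Suc k"
      by (simp add: b_def)
    then have "(1 - ?X) * b (Suc l) = ?X * ((1 - ?X) * b l) + (1 - ?X) * of_bool (Suc l \<le> k) * ?X ^ Suc k"
      by (simp add: algebra_simps)
    also have "\<dots> = ?X ^ max (Suc k) (Suc (Suc l)) - ?X ^ Suc (k + Suc l)"
    proof (cases "Suc l \<le> k")
      case True
      then have "max (Suc k) (Suc l) = Suc k" "max (Suc k) (Suc (Suc l)) = Suc k"
        by simp_all
      then show ?thesis
        unfolding Suc using True by (simp only: of_bool_eq mult_1_right) (simp add: algebra_simps)
    next
      case False
      then have "max (Suc k) (Suc l) = Suc l" "max (Suc k) (Suc (Suc l)) = Suc (Suc l)"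
        by simp_all
      then show ?thesis
        unfolding Suc using False by (simp only: of_bool_eq) (simp add: algebra_simps)
    qed
    finally show ?case .
  qed
  have "1 - ?X \<noteq> 0"
  proof
    assume "1 - ?X = 0"
    then have "(1 - ?X) $ 0 = 0" by simp
    then show False by simp
  qed
  then have "b l = (?X ^ max (Suc k) (Suc l) - ?X ^ Suc (k + l)) / (1 - ?X)"
    using key[of l] by (metis nonzero_mult_div_cancel_left)
  then show ?thesis by (simp add: b_def algebra_simps)
qed

text \<open>
  The final run lies in \<open>\<tau>\<close>, which leaves \<open>\<sigma>\<close> free at its end, or \<open>\<tau>\<close> is empty and both
  conditions bear on \<open>\<sigma>\<close>.
\<close>

lemma avoider_gf_inc_inc:
  "avoider_gf (\<lambda>\<pi>. begins_inc (Suc k) \<pi> \<and> ends_inc (Suc l) \<pi>) =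
     fps_X ^ Suc (k + l) * catalan_gf ^ Suc (Suc l)
       + (fps_X ^ max (Suc k) (Suc l) - fps_X ^ Suc (k + l)) / (1 - fps_X)"
proof (rule run_recurrence_solution)
  show "avoider_gf (\<lambda>\<pi>. begins_inc (Suc k) \<pi> \<and> ends_inc 0 \<pi>) = fps_X ^ Suc k * catalan_gf ^ 2"
    by (simp add: avoider_gf_begins_inc)
next
  fix l
  let ?A = "\<lambda>l. avoider_gf (\<lambda>\<pi>. begins_inc (Suc k) \<pi> \<and> ends_inc l \<pi>)"
  have "pair_gf (\<lambda>\<sigma> \<tau>. begins_inc (Suc k) (join \<sigma> \<tau>) \<and> ends_inc (Suc l) (join \<sigma> \<tau>)) =
    pair_gf (\<lambda>\<sigma> \<tau>. ((begins_inc (Suc k) \<sigma> \<or> \<sigma> = ascending k) \<and> ends_inc (Suc l) \<tau>) \<or>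
      ((begins_inc (Suc k) \<sigma> \<and> ends_inc l \<sigma> \<or> \<sigma> = ascending k \<and> ends_inc l \<sigma>) \<and> \<tau> = []))"
    by (rule pair_gf_cong) (auto simp add: begins_inc_join ends_inc_join)
  also have "\<dots> = fps_X ^ k * catalan_gf * avoider_gf (ends_inc (Suc l)) +
     avoider_gf (\<lambda>\<sigma>. begins_inc (Suc k) \<sigma> \<and> ends_inc l \<sigma> \<or> \<sigma> = ascending k \<and> ends_inc l \<sigma>)"
    by (subst pair_gf_disj)
       (auto simp: pair_gf_prod avoider_gf_left_part_begins_inc avoider_gf_eq_Nil)
  also have "avoider_gf (\<lambda>\<sigma>. begins_inc (Suc k) \<sigma> \<and> ends_inc l \<sigma> \<or> \<sigma> = ascending k \<and> ends_inc l \<sigma>)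
      = ?A l + of_bool (l \<le> k) * fps_X ^ k"
    by (subst avoider_gf_disj)
       (auto simp: runs_ascending
          avoider_gf_singleton[OF ascending_in_avoiders])
  finally show "?A (Suc l) = fps_X * (fps_X ^ k * catalan_gf * (fps_X ^ Suc l * catalan_gf ^ Suc (Suc l))
                 + ?A l + of_bool (l \<le> k) * fps_X ^ k)"
    unfolding avoider_gf_ends_inc by (subst avoider_gf_decompose) (simp add: add.assoc)
qed

text \<open>
  Exchanging the two parts of the cut turns this case into the previous one, so the same recurrence
  appears, now in \<open>k\<close>.
\<close>

lemma avoider_gf_dec_dec:
  "avoider_gf (\<lambda>\<pi>. begins_dec (Suc k) \<pi> \<and> ends_dec (Suc l) \<pi>) =
     fps_X ^ Suc (k + l) * catalan_gf ^ Suc (Suc k)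
       + (fps_X ^ max (Suc k) (Suc l) - fps_X ^ Suc (k + l)) / (1 - fps_X)"
proof -
  let ?A = "\<lambda>k. avoider_gf (\<lambda>\<pi>. begins_dec k \<pi> \<and> ends_dec (Suc l) \<pi>)"
  have "?A (Suc k) = fps_X ^ Suc (l + k) * catalan_gf ^ Suc (Suc k)
       + (fps_X ^ max (Suc l) (Suc k) - fps_X ^ Suc (l + k)) / (1 - fps_X)"
  proof (rule run_recurrence_solution)
    show "?A 0 = fps_X ^ Suc l * catalan_gf ^ 2"
      by (simp add: avoider_gf_ends_dec)
  next
    fix k
    have "pair_gf (\<lambda>\<sigma> \<tau>. begins_dec (Suc k) (join \<sigma> \<tau>) \<and> ends_dec (Suc l) (join \<sigma> \<tau>)) =
      pair_gf (\<lambda>\<sigma> \<tau>. (begins_dec (Suc k) \<sigma> \<and> (ends_dec (Suc l) \<tau> \<or> \<tau> = descending l)) \<or>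
        (\<sigma> = [] \<and> (begins_dec k \<tau> \<and> ends_dec (Suc l) \<tau> \<or> \<tau> = descending l \<and> begins_dec k \<tau>)))"
      by (rule pair_gf_cong) (auto simp add: begins_dec_join ends_dec_join)
    also have "\<dots> = avoider_gf (begins_dec (Suc k)) * (fps_X ^ l * catalan_gf) +
       avoider_gf (\<lambda>\<tau>. begins_dec k \<tau> \<and> ends_dec (Suc l) \<tau> \<or> \<tau> = descending l \<and> begins_dec k \<tau>)"
      by (subst pair_gf_disj)
         (auto simp: pair_gf_prod avoider_gf_right_part_ends_dec avoider_gf_eq_Nil)
    also have "avoider_gf (\<lambda>\<tau>. begins_dec k \<tau> \<and> ends_dec (Suc l) \<tau> \<or> \<tau> = descending l \<and> begins_dec k \<tau>)
        = ?A k + of_bool (k \<le> l) * fps_X ^ l"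
      by (subst avoider_gf_disj)
         (auto simp: runs_descending
            avoider_gf_singleton[OF descending_in_avoiders])
    finally show "?A (Suc k) = fps_X * (fps_X ^ l * catalan_gf * (fps_X ^ Suc k * catalan_gf ^ Suc (Suc k))
                   + ?A k + of_bool (k \<le> l) * fps_X ^ l)"
      unfolding avoider_gf_begins_dec by (subst avoider_gf_decompose) (simp add: mult_ac add_ac)
  qed
  then show ?thesis by (simp add: add.commute max.commute)
qed

lemma avoider_gf_inc_dec:
  "avoider_gf (\<lambda>\<pi>. begins_inc (Suc k) \<pi> \<and> ends_dec (Suc l) \<pi>) = fps_X ^ Suc (k + l) * catalan_gf ^ 2"
proof -
  have "pair_gf (\<lambda>\<sigma> \<tau>. begins_inc (Suc k) (join \<sigma> \<tau>) \<and> ends_dec (Suc l) (join \<sigma> \<tau>)) =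
    pair_gf (\<lambda>\<sigma> \<tau>. (begins_inc (Suc k) \<sigma> \<or> \<sigma> = ascending k) \<and>
      (ends_dec (Suc l) \<tau> \<or> \<tau> = descending l))"
    by (rule pair_gf_cong) (simp add: begins_inc_join ends_dec_join)
  then show ?thesis
    unfolding pair_gf_prod avoider_gf_left_part_begins_inc avoider_gf_right_part_ends_dec
    by (subst avoider_gf_decompose) (simp add: power_add power2_eq_square mult_ac)
qed

text \<open>
  Each condition has two alternatives, which gives four summands. The last one, in which both parts
  are empty, is the one-element permutation; it satisfies the conditions only for \<open>k = l = 0\<close>.
\<close>

lemma avoider_gf_dec_inc:
  "avoider_gf (\<lambda>\<pi>. begins_dec (Suc k) \<pi> \<and> ends_inc (Suc l) \<pi>) =
     fps_X * (avoider_gf (begins_dec (Suc k)) * avoider_gf (ends_inc (Suc l))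
       + avoider_gf (\<lambda>\<pi>. begins_dec (Suc k) \<pi> \<and> ends_inc l \<pi>)
       + avoider_gf (\<lambda>\<pi>. begins_dec k \<pi> \<and> ends_inc (Suc l) \<pi>)
       + of_bool (k = 0 \<and> l = 0))"
proof -
  have "pair_gf (\<lambda>\<sigma> \<tau>. begins_dec (Suc k) (join \<sigma> \<tau>) \<and> ends_inc (Suc l) (join \<sigma> \<tau>)) =
    pair_gf (\<lambda>\<sigma> \<tau>. (((begins_dec (Suc k) \<sigma> \<and> ends_inc (Suc l) \<tau>) \<or>
      ((begins_dec (Suc k) \<sigma> \<and> ends_inc l \<sigma>) \<and> \<tau> = [])) \<or>
      (\<sigma> = [] \<and> (begins_dec k \<tau> \<and> ends_inc (Suc l) \<tau>))) \<or>
      ((\<sigma> = [] \<and> ends_inc l \<sigma>) \<and> (\<tau> = [] \<and> begins_dec k \<tau>)))"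
    by (rule pair_gf_cong) (auto simp add: begins_dec_join ends_inc_join)
  also have "\<dots> = avoider_gf (begins_dec (Suc k)) * avoider_gf (ends_inc (Suc l))
       + avoider_gf (\<lambda>\<pi>. begins_dec (Suc k) \<pi> \<and> ends_inc l \<pi>)
       + avoider_gf (\<lambda>\<pi>. begins_dec k \<pi> \<and> ends_inc (Suc l) \<pi>)
       + of_bool (l = 0) * of_bool (k = 0)"
    apply (subst pair_gf_disj, fastforce)
    apply (subst pair_gf_disj, fastforce)
    apply (subst pair_gf_disj, fastforce)
    unfolding pair_gf_prod avoider_gf_eq_Nil avoider_gf_Nil by simp
  finally show ?thesis by (subst avoider_gf_decompose) simp
qed

lemma perm_gf_eq_avoider_gf:
  "perm_gf avoids_132 B E = avoider_gf (\<lambda>\<pi>. B \<pi> \<and> E \<pi>) - of_bool (B [] \<and> E [])"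
proof (rule fps_ext)
  fix n
  have "{\<pi> \<in> permutations_of_set {1..n}. avoids_132 \<pi> \<and> B \<pi> \<and> E \<pi>} = {\<pi> \<in> avoiders n. B \<pi> \<and> E \<pi>}"
    by (auto simp: avoiders_def)
  moreover have "{\<pi>. \<pi> = [] \<and> B \<pi> \<and> E \<pi>} = (if B [] \<and> E [] then {[]} else {})" by auto
  ultimately show "perm_gf avoids_132 B E $ n =
      (avoider_gf (\<lambda>\<pi>. B \<pi> \<and> E \<pi>) - of_bool (B [] \<and> E [])) $ n"
    by (cases n) (simp_all add: perm_gf_def perm_count_def avoider_gf_def)
qed

section \<open>The series in three variables\<close>

lemma fps3_eqI: "(\<And>l k. F $ l $ k = G $ l $ k) \<Longrightarrow> F = (G :: real fps fps fps)"
  by (intro fps_ext) simp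

lemma fps3_mult_nth:
  fixes F :: "real fps fps fps"
  shows "(x_in_xyz f * F) $ l $ k = f * F $ l $ k"
    and "(var_y * F) $ l $ k = (if k = 0 then 0 else F $ l $ (k - 1))"
    and "(var_z * F) $ l $ k = (if l = 0 then 0 else F $ (l - 1) $ k)"
  by (simp_all add: x_in_xyz_def var_y_def var_z_def)

lemma fps3_var_nth:
  "x_in_xyz f $ l $ k = (if l = 0 \<and> k = 0 then f else 0)"
  "var_y $ l $ k = of_bool (l = 0 \<and> k = 1)"
  "var_z $ l $ k = of_bool (l = 1 \<and> k = 0)"
  by (simp_all add: x_in_xyz_def var_y_def var_z_def fps_X_def)

lemma perm_gf3_nth:
  "perm_gf3 $ l $ k =
     avoider_gf (\<lambda>\<pi>. begins_dec k \<pi> \<and> ends_inc l \<pi>) - of_bool (k = 0 \<and> l = 0)"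
  by (simp add: perm_gf3_def perm_gf_eq_avoider_gf)

lemma catalan_gf_minus_1: "catalan_gf - 1 = fps_X * catalan_gf ^ 2"
  using catalan_gf_rec by algebra

text \<open>
  For \<open>k, l \<ge> 1\<close> the coefficients are those of the four-term recurrence above, whose last summand
  accounts for \<open>x y z\<close>. If exactly one of \<open>k\<close> and \<open>l\<close> is zero, the one-condition recurrences take
  over. At \<open>(1, 0)\<close> and \<open>(0, 1)\<close> they refer to the coefficient at \<open>(0, 0)\<close>, from which the empty
  permutation is missing; this produces \<open>x y\<close> and \<open>x z\<close>. The coefficient at \<open>(0, 0)\<close> itself is
  \<open>C - 1 = x C\<^sup>2\<close>.
\<close>

lemma perm_gf3_functional_equation:
  "(1 - var_x * (var_y + var_z)) * perm_gf3 =
     var_x * (var_y + var_z + var_y * var_z) +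
     Abs_fps (\<lambda>l. Abs_fps (\<lambda>k. fps_X * avoider_gf (begins_dec k) * avoider_gf (ends_inc l)))"
  (is "_ = _ + ?W")
proof -
  let ?G = perm_gf3 and ?x = "x_in_xyz fps_X"
  have "?G - ?x * (var_y * ?G) - ?x * (var_z * ?G) =
    ?x * var_y + ?x * var_z + ?x * (var_y * var_z) + ?W" (is "?L = ?R")
  proof (rule fps3_eqI)
    fix l k
    have L: "?L $ l $ k = ?G $ l $ k - fps_X * (if k = 0 then 0 else ?G $ l $ (k - 1))
        - fps_X * (if l = 0 then 0 else ?G $ (l - 1) $ k)"
      by (simp add: fps3_mult_nth)
    have R: "?R $ l $ k = fps_X * of_bool (l = 0 \<and> k = 1) + fps_X * of_bool (l = 1 \<and> k = 0)
        + fps_X * of_bool (l = 1 \<and> k = 1) + fps_X * avoider_gf (begins_dec k) * avoider_gf (ends_inc l)"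
      by (auto simp add: fps3_mult_nth fps3_var_nth)
    have zero: "avoider_gf (begins_dec 0) = catalan_gf" "avoider_gf (ends_inc 0) = catalan_gf"
      by (simp_all add: avoider_gf_begins_dec avoider_gf_ends_inc)
    show "?L $ l $ k = ?R $ l $ k"
    proof (cases k; cases l)
      assume "k = 0" "l = 0"
      then show ?thesis
        unfolding L R using catalan_gf_minus_1
        by (simp add: perm_gf3_nth avoider_gf_True zero power2_eq_square mult.assoc)
    next
      fix l' assume "k = 0" "l = Suc l'"
      then show ?thesis
        unfolding L R using avoider_gf_ends_inc_rec[of l']
        by (simp add: perm_gf3_nth zero algebra_simps)
    next
      fix k' assume "k = Suc k'" "l = 0"
      then show ?thesis
        unfolding L R using avoider_gf_begins_dec_rec[of k']
        by (simp add: perm_gf3_nth zero algebra_simps)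
    next
      fix k' l' assume "k = Suc k'" "l = Suc l'"
      then show ?thesis
        unfolding L R using avoider_gf_dec_inc[of k' l']
        by (simp add: perm_gf3_nth algebra_simps)
    qed
  qed
  then show ?thesis
    by (simp add: var_x_def algebra_simps)
qed

text \<open>
  The coefficient at \<open>(k, l)\<close> is \<open>x C\<^sup>2 (x C)\<^sup>k (x C)\<^sup>l\<close>, and \<open>x C\<^sup>2 = C - 1\<close>.
\<close>

lemma geometric_gf3:
  "Abs_fps (\<lambda>l. Abs_fps (\<lambda>k. fps_X * avoider_gf (begins_dec k) * avoider_gf (ends_inc l))) *
     ((1 - var_x * var_y * x_in_xyz catalan_gf) * (1 - var_x * var_z * x_in_xyz catalan_gf)) =
   x_in_xyz catalan_gf - 1"
  (is "?W * ((1 - ?x * ?y * ?C) * (1 - ?x * ?z * ?C)) = _")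
proof -
  \<comment> \<open>Multiplication by the first factor leaves only the terms without \<open>y\<close>.\<close>
  define Z where "Z = ?W - ?x * (?y * (?C * ?W))"
  have Z: "Z $ l $ k = of_bool (k = 0) * (fps_X * catalan_gf * (fps_X ^ l * catalan_gf ^ Suc l))" for l k
    by (cases k) (simp_all add: Z_def var_x_def fps3_mult_nth avoider_gf_begins_dec avoider_gf_ends_inc mult_ac)
  have "Z - ?x * (?z * (?C * Z)) = ?C - 1"
  proof (rule fps3_eqI)
    fix l k
    have "(Z - ?x * (?z * (?C * Z))) $ l $ k =
        Z $ l $ k - fps_X * (if l = 0 then 0 else catalan_gf * Z $ (l - 1) $ k)"
      by (simp add: var_x_def fps3_mult_nth)
    also have "\<dots> = (if l = 0 \<and> k = 0 then catalan_gf - 1 else 0)"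
      unfolding Z catalan_gf_minus_1 by (cases l) (simp_all add: power2_eq_square mult_ac)
    also have "\<dots> = (?C - 1) $ l $ k"
      by (simp add: fps3_var_nth)
    finally show "(Z - ?x * (?z * (?C * Z))) $ l $ k = (?C - 1) $ l $ k" .
  qed
  then show ?thesis by (simp add: Z_def algebra_simps)
qed

theorem proposition10:
  shows "(\<forall>k\<ge>1. \<forall>l\<ge>1. let m = max k l; x = (fps_X :: real fps); C = catalan_gf in
            perm_gf avoids_132 (begins_inc k) (ends_inc l)
              = x ^ (k + l - 1) * C ^ (l + 1) + (x ^ m - x ^ (k + l - 1)) / (1 - x)
          \<and> perm_gf avoids_132 (begins_inc k) (ends_dec l)
              = x ^ (k + l - 1) * C ^ 2
          \<and> perm_gf avoids_132 (begins_dec k) (ends_dec l)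
              = x ^ (k + l - 1) * C ^ (k + 1) + (x ^ m - x ^ (k + l - 1)) / (1 - x))
       \<and> (let x = var_x; y = var_y; z = var_z; C = x_in_xyz catalan_gf in
            perm_gf3 = 1 / (1 - x * (y + z)) *
              (x * (y + z + y * z) + (C - 1) / ((1 - x * y * C) * (1 - x * z * C))))"
proof (intro conjI allI impI)
  fix k l :: nat
  assume "1 \<le> k" "1 \<le> l"
  then obtain k' l' where "k = Suc k'" "l = Suc l'"
    by (metis Suc_le_D One_nat_def)
  then show "let m = max k l; x = (fps_X :: real fps); C = catalan_gf in
            perm_gf avoids_132 (begins_inc k) (ends_inc l)
              = x ^ (k + l - 1) * C ^ (l + 1) + (x ^ m - x ^ (k + l - 1)) / (1 - x)
          \<and> perm_gf avoids_132 (begins_inc k) (ends_dec l)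
              = x ^ (k + l - 1) * C ^ 2
          \<and> perm_gf avoids_132 (begins_dec k) (ends_dec l)
              = x ^ (k + l - 1) * C ^ (k + 1) + (x ^ m - x ^ (k + l - 1)) / (1 - x)"
    by (simp add: Let_def perm_gf_eq_avoider_gf avoider_gf_inc_inc avoider_gf_inc_dec
        avoider_gf_dec_dec del: power_Suc max_Suc_Suc)
next
  let ?x = var_x and ?y = var_y and ?z = var_z and ?C = "x_in_xyz catalan_gf"
  let ?M = "1 - ?x * (?y + ?z)" and ?Q = "(1 - ?x * ?y * ?C) * (1 - ?x * ?z * ?C)"
  let ?N = "?x * (?y + ?z + ?y * ?z)"
  let ?W = "Abs_fps (\<lambda>l. Abs_fps (\<lambda>k. fps_X * avoider_gf (begins_dec k) * avoider_gf (ends_inc l)))"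
  have M: "?M $ 0 $ 0 $ 0 \<noteq> 0"
    by (simp add: var_x_def var_y_def var_z_def x_in_xyz_def)
  have Q: "?Q $ 0 $ 0 $ 0 \<noteq> 0"
    by (simp add: var_x_def var_y_def var_z_def x_in_xyz_def)
  then have "?Q \<noteq> 0" by (metis fps_zero_nth)
  moreover have "((?C - 1) / ?Q) * ?Q = ?W * ?Q"
    using fps3_divide_mult_cancel[OF Q] geometric_gf3 by simp
  ultimately have W: "(?C - 1) / ?Q = ?W"
    by simp
  have "perm_gf3 = (1 / ?M * ?M) * perm_gf3"
    using fps3_divide_mult_cancel[OF M] by simp
  also have "\<dots> = 1 / ?M * (?N + ?W)"
    using perm_gf3_functional_equation by (simp add: mult.assoc)
  finally show "let x = ?x; y = ?y; z = ?z; C = ?C in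
            perm_gf3 = 1 / (1 - x * (y + z)) *
              (x * (y + z + y * z) + (C - 1) / ((1 - x * y * C) * (1 - x * z * C)))"
    unfolding Let_def W .
qed

end
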